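(* Let $C$ be a $(K,F,r)$-computing matrix (of size $K\times F$) with a non-overlapping identity submatrix cover $\mathfrak{C}=\{C_1,\dots,C_S\}$ in which each identity submatrix has size $g\geq 2$. Then there exists a distributed computing scheme with $K$ nodes, attaining computation load $r$ and communication load $L=\frac{2}{g}\left(1-\frac{r}{K}\right)$, with file complexity $F$.
   Context: Identity submatrices: an $l\times l$ submatrix $B$ of a binary ($0/1$) matrix $A$ is an identity submatrix of size $l$ if its columns are those of the $l\times l$ identity matrix in some order, i.e. $B$ is a permutation matrix. An entry $A(i,j)=1$ is covered by $B$ if $i$ is a row index and $j$ a column index of $B$. A set $\{C_1,\dots,C_S\}$ of identity submatrices of $A$ is an identity submatrix cover of $A$ if each non-zero entry of $A$ is covered by at least one $C_i$; it is non-overlapping if no non-zero entry is covered by two distinct members. Coded MapReduce model: there are $K$ servers (nodes) indexed by $\mathcal{K}$, and an input file divided into $F$ subfiles indexed by $\mathcal{F}$, $|\mathcal{F}|=F\geq K$; $F$ is the file complexity. There are $Q$ output functions $\phi_1,\dots,\phi_Q$ of the whole file, with $\beta=Q/K$ an integer. For $q\in[Q]$, $f\in\mathcal{F}$, a map function $g_{q,f}$ produces from subfile $f$ an intermediate value (IVA) $v_{q,f}=g_{q,f}(f)$, an arbitrary string of $T$ bits, and a reduce function $h_q$ satisfies $\phi_q(\text{all subfiles})=h_q(\{v_{q,f}:f\in\mathcal{F}\})$. A distributed computing scheme has three phases. Map: each subfile is assigned to $r$ servers ($r$ is the computation load); with $\mathcal{M}_k\subseteq\mathcal{F}$ the subfiles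 assigned to server $k$, server $k$ computes $v_{q,f}$ for all $q\in[Q]$, $f\in\mathcal{M}_k$. Shuffle: server $k$ is responsible for a set $\mathcal{W}_k\subset[Q]$ of $\beta$ functions, these sets being disjoint with union $[Q]$; servers broadcast messages (each a function of the IVAs computed by the transmitting server) so that each server $k$ can recover all $v_{q,f}$, $q\in\mathcal{W}_k$, $f\notin\mathcal{M}_k$, from the broadcasts and its own IVAs. Reduce: server $k$ computes $h_q(\{v_{q,f}:f\in\mathcal{F}\})$ for each $q\in\mathcal{W}_k$. The communication load is $L=\frac{\text{total number of bits transmitted in the shuffle phase}}{QFT}$. Computing matrix: a binary matrix $C$ with rows indexed by a $K$-set $\mathcal{K}$ and columns by an $F$-set $\mathcal{F}$ such that each column has the same number $r$ of $0$'s is a $(K,F,r)$-computing matrix; it defines the scheme in which server $k$ maps subfile $f$ if $C(k,f)=0$ and does not map it if $C(k,f)=1$. *)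

theory Defs
  imports Complex_Main "HOL-Library.FuncSet" "HOL-Library.Disjoint_Sets"
begin

text \<open>
  Matrices are functions \<open>C :: 'k \<Rightarrow> 'f \<Rightarrow> nat\<close> read on a finite row set \<open>Ks\<close> and a finite column
  set \<open>Fs\<close> only. A submatrix is the pair of its row set and its column set: neither
  being an identity submatrix nor covering an entry depends on how rows and columns are listed.
\<close>

definition computing_matrix ::
  "'k set \<Rightarrow> 'f set \<Rightarrow> nat \<Rightarrow> nat \<Rightarrow> nat \<Rightarrow> ('k \<Rightarrow> 'f \<Rightarrow> nat) \<Rightarrow> bool" where
  "computing_matrix Ks Fs K F r C \<longleftrightarrow>
     finite Ks \<and> card Ks = K \<and> finite Fs \<and> card Fs = F \<and>
     (\<forall>k\<in>Ks. \<forall>f\<in>Fs. C k f \<in> {0, 1}) \<and>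
     (\<forall>f\<in>Fs. card {k \<in> Ks. C k f = 0} = r)"

definition identity_submatrix ::
  "'k set \<Rightarrow> 'f set \<Rightarrow> ('k \<Rightarrow> 'f \<Rightarrow> nat) \<Rightarrow> nat \<Rightarrow> 'k set \<times> 'f set \<Rightarrow> bool" where
  "identity_submatrix Ks Fs C l B \<longleftrightarrow>
     fst B \<subseteq> Ks \<and> snd B \<subseteq> Fs \<and> card (fst B) = l \<and> card (snd B) = l \<and>
     (\<exists>\<sigma>. bij_betw \<sigma> (fst B) (snd B) \<and>
          (\<forall>k\<in>fst B. \<forall>f\<in>snd B. C k f = (if f = \<sigma> k then 1 else 0)))"

definition covers :: "'k set \<times> 'f set \<Rightarrow> 'k \<Rightarrow> 'f \<Rightarrow> bool" where
  "covers B k f \<longleftrightarrow> k \<in> fst B \<and> f \<in> snd B"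

definition identity_submatrix_cover ::
  "'k set \<Rightarrow> 'f set \<Rightarrow> ('k \<Rightarrow> 'f \<Rightarrow> nat) \<Rightarrow> ('k set \<times> 'f set) set \<Rightarrow> bool" where
  "identity_submatrix_cover Ks Fs C \<CC> \<longleftrightarrow>
     (\<forall>B\<in>\<CC>. \<exists>l. identity_submatrix Ks Fs C l B) \<and>
     (\<forall>k\<in>Ks. \<forall>f\<in>Fs. C k f \<noteq> 0 \<longrightarrow> (\<exists>B\<in>\<CC>. covers B k f))"

definition non_overlapping ::
  "'k set \<Rightarrow> 'f set \<Rightarrow> ('k \<Rightarrow> 'f \<Rightarrow> nat) \<Rightarrow> ('k set \<times> 'f set) set \<Rightarrow> bool" where
  "non_overlapping Ks Fs C \<CC> \<longleftrightarrow>
     (\<forall>k\<in>Ks. \<forall>f\<in>Fs. C k f \<noteq> 0 \<longrightarrow>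
        (\<forall>B\<in>\<CC>. \<forall>B'\<in>\<CC>. covers B k f \<and> covers B' k f \<longrightarrow> B = B'))"

text \<open>
  A MapReduce problem: servers \<open>Ks\<close>, subfiles \<open>Fs\<close>, functions \<open>{1..Q}\<close>, intermediate values (IVAs)
  of \<open>T\<close> bits, map functions \<open>m\<close>, reduce functions \<open>h\<close> and output functions \<open>\<phi>\<close>. An input file is
  a family \<open>x :: 'f \<Rightarrow> 'w\<close> giving the contents \<open>x f\<close> of each subfile \<open>f\<close>.
\<close>

locale mapreduce_problem =
  fixes Ks :: "'k set" and Fs :: "'f set" and Q T :: nat
    and m :: "nat \<Rightarrow> 'f \<Rightarrow> 'w \<Rightarrow> bool list"
    and h :: "nat \<Rightarrow> ('f \<Rightarrow> bool list) \<Rightarrow> 'o"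
    and \<phi> :: "nat \<Rightarrow> ('f \<Rightarrow> 'w) \<Rightarrow> 'o"
  assumes finite_servers: "finite Ks" and servers_nonempty: "Ks \<noteq> {}"
    and finite_subfiles: "finite Fs" and servers_le_subfiles: "card Ks \<le> card Fs"
    and Q_pos: "Q > 0" and servers_dvd_Q: "card Ks dvd Q" and T_pos: "T > 0"
    and length_map: "\<And>q f c. q \<in> {1..Q} \<Longrightarrow> f \<in> Fs \<Longrightarrow> length (m q f c) = T"
    and output_eq: "\<And>q x. q \<in> {1..Q} \<Longrightarrow> \<phi> q x = h q (\<lambda>f\<in>Fs. m q f (x f))"

type_synonym 'f ivas = "nat \<times> 'f \<Rightarrow> bool list"

text \<open>
  The number of bits of a broadcast is a fixed attribute, so that a message cannot carry
  information through its length.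
\<close>

record ('k, 'f) broadcast =
  sender :: 'k
  nbits :: nat
  encode :: "'f ivas \<Rightarrow> bool list"

record ('k, 'f) scheme =
  mapped :: "'k \<Rightarrow> 'f set"
  assigned :: "'k \<Rightarrow> nat set"
  broadcasts :: "('k, 'f) broadcast list"
  decode :: "'k \<Rightarrow> bool list list \<Rightarrow> 'f ivas \<Rightarrow> 'f ivas"

definition local_ivas :: "nat \<Rightarrow> ('k, 'f) scheme \<Rightarrow> 'f ivas \<Rightarrow> 'k \<Rightarrow> 'f ivas" where
  "local_ivas Q S v k = restrict v ({1..Q} \<times> mapped S k)"

definition message :: "nat \<Rightarrow> ('k, 'f) scheme \<Rightarrow> 'f ivas \<Rightarrow> ('k, 'f) broadcast \<Rightarrow> bool list" where
  "message Q S v b = encode b (local_ivas Q S v (sender b))"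

definition decoded :: "nat \<Rightarrow> ('k, 'f) scheme \<Rightarrow> 'f ivas \<Rightarrow> 'k \<Rightarrow> 'f ivas" where
  "decoded Q S v k = decode S k (map (message Q S v) (broadcasts S)) (local_ivas Q S v k)"

definition gathered :: "nat \<Rightarrow> ('k, 'f) scheme \<Rightarrow> 'f ivas \<Rightarrow> 'k \<Rightarrow> 'f ivas" where
  "gathered Q S v k = (\<lambda>(q, f).
     if f \<in> mapped S k then local_ivas Q S v k (q, f) else decoded Q S v k (q, f))"

text \<open>
  Encoding and decoding have to work for arbitrary \<open>T\<close>-bit IVAs, not only for those that
  arise from the given map functions.
\<close>

definition distributed_computing_scheme ::
  "'k set \<Rightarrow> 'f set \<Rightarrow> nat \<Rightarrow> nat \<Rightarrow> (nat \<Rightarrow> 'f \<Rightarrow> 'w \<Rightarrow> bool list) \<Rightarrow>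
   (nat \<Rightarrow> ('f \<Rightarrow> bool list) \<Rightarrow> 'o) \<Rightarrow> (nat \<Rightarrow> ('f \<Rightarrow> 'w) \<Rightarrow> 'o) \<Rightarrow> ('k, 'f) scheme \<Rightarrow> bool" where
  "distributed_computing_scheme Ks Fs Q T m h \<phi> S \<longleftrightarrow>
     (\<forall>k\<in>Ks. mapped S k \<subseteq> Fs) \<and>
     (\<forall>k\<in>Ks. card (assigned S k) = Q div card Ks) \<and>
     disjoint_family_on (assigned S) Ks \<and>
     (\<Union>k\<in>Ks. assigned S k) = {1..Q} \<and>
     (\<forall>b\<in>set (broadcasts S). sender b \<in> Ks) \<and>
     (\<forall>v \<in> {1..Q} \<times> Fs \<rightarrow> {s. length s = T}.
        (\<forall>b\<in>set (broadcasts S). length (message Q S v b) = nbits b) \<and>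
        (\<forall>k\<in>Ks. \<forall>q\<in>assigned S k. \<forall>f\<in>Fs - mapped S k. decoded Q S v k (q, f) = v (q, f))) \<and>
     (\<forall>x. \<forall>k\<in>Ks. \<forall>q\<in>assigned S k.
        h q (\<lambda>f\<in>Fs. gathered Q S (\<lambda>(q, f). m q f (x f)) k (q, f)) = \<phi> q x)"

definition has_computation_load :: "'k set \<Rightarrow> 'f set \<Rightarrow> ('k, 'f) scheme \<Rightarrow> nat \<Rightarrow> bool" where
  "has_computation_load Ks Fs S r \<longleftrightarrow> (\<forall>f\<in>Fs. card {k \<in> Ks. f \<in> mapped S k} = r)"

definition communication_load :: "'f set \<Rightarrow> nat \<Rightarrow> nat \<Rightarrow> ('k, 'f) scheme \<Rightarrow> real" where
  "communication_load Fs Q T S =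
     real (\<Sum>b\<leftarrow>broadcasts S. nbits b) / (real Q * real (card Fs) * real T)"

end

theory Submission
  imports Defs
begin

text \<open>
  The \<open>g\<close> ones of an identity submatrix are \<open>g\<close> demands, one per row, and each row server knows
  every demand but its own. So two transmissions serve the whole submatrix: one row server
  broadcasts the XOR of all the demands of the others, and any second row server broadcasts the
  demand of the first. Doing this for each of the \<open>Q / K\<close> functions of a server costs
  \<open>2 (Q / K) T S\<close> bits, and counting the ones of \<open>C\<close> by columns and by submatrices gives
  \<open>F (K - r) = g S\<close>.
\<close>

section \<open>XOR transmissions and the schemes built from them\<close>

definition xor_bits :: "nat \<Rightarrow> (nat \<times> 'f) set \<Rightarrow> 'f ivas \<Rightarrow> bool list" where
  "xor_bits T D u = map (\<lambda>t. odd (card {p \<in> D. u p ! t})) [0..<T]"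

text \<open>A transmission is a pair of its sender and the set of IVA indices that it adds up.
  Declaring \<open>T\<close> bits is always honest, since \<open>xor_bits\<close> fixes its length
  independently of the IVAs.\<close>

definition xor_broadcast :: "nat \<Rightarrow> 'k \<times> (nat \<times> 'f) set \<Rightarrow> ('k, 'f) broadcast" where
  "xor_broadcast T x = \<lparr>sender = fst x, nbits = T, encode = xor_bits T (snd x)\<rparr>"

text \<open>The index set \<open>N\<close> stands for the IVAs known to the decoding server.\<close>

definition xor_decode ::
  "nat \<Rightarrow> ('k \<times> (nat \<times> 'f) set) list \<Rightarrow> (nat \<times> 'f) set \<Rightarrow> bool list list \<Rightarrow> 'f ivas \<Rightarrow> 'f ivas" where
  "xor_decode T L N msgs u p =
     (let x = SOME x. x \<in> set L \<and> p \<in> snd x \<and> snd x - {p} \<subseteq> N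
      in map2 (\<noteq>) (the (map_of (zip L msgs) x)) (xor_bits T (snd x - {p}) u))"

definition xor_scheme ::
  "nat \<Rightarrow> nat \<Rightarrow> ('k \<Rightarrow> 'f set) \<Rightarrow> ('k \<Rightarrow> nat set) \<Rightarrow> ('k \<times> (nat \<times> 'f) set) list \<Rightarrow> ('k, 'f) scheme" where
  "xor_scheme Q T M W L =
     \<lparr>mapped = M, assigned = W, broadcasts = map (xor_broadcast T) L,
      decode = (\<lambda>k. xor_decode T L ({1..Q} \<times> M k))\<rparr>"

text \<open>The sum over \<open>D\<close> reads \<open>u\<close> only on \<open>D\<close>, so any
  server knowing \<open>D\<close> can compute it locally. This serves both the sender and the
  decoding receiver.\<close>

lemma xor_bits_restrict:
  assumes "D \<subseteq> N"
  shows "xor_bits T D (restrict u N) = xor_bits T D u"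
proof -
  have "{p \<in> D. restrict u N p ! t} = {p \<in> D. u p ! t}" for t
    using assms by (auto simp: subset_iff)
  then show ?thesis by (simp add: xor_bits_def)
qed

lemma odd_card_remove:
  assumes "finite D" "p \<in> D"
  shows "odd (card {q \<in> D. P q}) \<longleftrightarrow> P p \<noteq> odd (card {q \<in> D - {p}. P q})"
proof (cases "P p")
  case True
  then have "{q \<in> D. P q} = insert p {q \<in> D - {p}. P q}" using assms by auto
  then show ?thesis using True assms by simp
next
  case False
  then have "{q \<in> D. P q} = {q \<in> D - {p}. P q}" by auto
  then show ?thesis using False by simp
qed

text \<open>XOR is its own inverse: bit by bit, the two parities differ exactly by the bit of
  \<open>u p\<close>. The length assumption makes the result all of \<open>u p\<close>.\<close>

lemma xor_bits_cancel:
  assumes "finite D" "p \<in> D" "length (u p) = T"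
  shows "map2 (\<noteq>) (xor_bits T D u) (xor_bits T (D - {p}) u) = u p"
  using assms odd_card_remove[OF assms(1,2), of "\<lambda>q. u q ! _"]
  by (intro nth_equalityI) (auto simp: xor_bits_def)

lemma message_xor_broadcast:
  assumes "snd x \<subseteq> {1..Q} \<times> mapped S (fst x)"
  shows "message Q S v (xor_broadcast T x) = xor_bits T (snd x) v"
  using assms by (simp add: message_def xor_broadcast_def local_ivas_def xor_bits_restrict)

text \<open>The chosen transmission contains \<open>p\<close> and otherwise only IVAs known to
  \<open>k\<close>, so \<open>k\<close> cancels the rest. The choice depends on index sets alone,
  never on IVA values, so it is available to the decoder.\<close>

lemma decoded_xor_scheme:
  assumes L: "\<And>x. x \<in> set L \<Longrightarrow> finite (snd x) \<and> snd x \<subseteq> {1..Q} \<times> M (fst x)"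
    and served: "\<exists>x\<in>set L. p \<in> snd x \<and> snd x - {p} \<subseteq> {1..Q} \<times> M k"
    and len: "length (v p) = T"
  shows "decoded Q (xor_scheme Q T M W L) v k p = v p"
proof -
  let ?S = "xor_scheme Q T M W L" and ?N = "{1..Q} \<times> M k"
  define x where "x = (SOME x. x \<in> set L \<and> p \<in> snd x \<and> snd x - {p} \<subseteq> ?N)"
  have x: "x \<in> set L" "p \<in> snd x" "snd x - {p} \<subseteq> ?N"
    using someI_ex[of "\<lambda>x. x \<in> set L \<and> p \<in> snd x \<and> snd x - {p} \<subseteq> ?N"] served
    unfolding x_def by blast+
  have "map (message Q ?S v) (broadcasts ?S) = map (\<lambda>x. xor_bits T (snd x) v) L"
    using L by (simp add: xor_scheme_def message_xor_broadcast)
  then have "decoded Q ?S v k p =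
      map2 (\<noteq>) (xor_bits T (snd x) v) (xor_bits T (snd x - {p}) (restrict v ?N))"
    \<comment> \<open>The message is looked up by the transmission itself. Repeated entries of
      \<open>L\<close> carry equal messages, so the first hit is the right one.\<close>
    using x(1) by (simp add: decoded_def xor_scheme_def xor_decode_def local_ivas_def
        map_of_zip_map Let_def del: One_nat_def flip: x_def)
  also have "\<dots> = v p"
    using x L len by (simp only: xor_bits_restrict) (blast intro: xor_bits_cancel)
  finally show ?thesis .
qed

text \<open>Separates coding from combinatorics: what remains for a concrete scheme is that senders
  know what they add up and that every missing IVA is the only unknown of some transmission.\<close>

lemma xor_scheme_correct:
  assumes "mapreduce_problem Ks Fs Q T m h \<phi>"
    and M: "\<And>k. k \<in> Ks \<Longrightarrow> M k \<subseteq> Fs"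
    and W: "\<And>k. k \<in> Ks \<Longrightarrow> card (W k) = Q div card Ks"
      "disjoint_family_on W Ks" "(\<Union>k\<in>Ks. W k) = {1..Q}"
    and L: "\<And>x. x \<in> set L \<Longrightarrow> fst x \<in> Ks \<and> finite (snd x) \<and> snd x \<subseteq> {1..Q} \<times> M (fst x)"
    and served: "\<And>k p. k \<in> Ks \<Longrightarrow> p \<in> W k \<times> (Fs - M k) \<Longrightarrow>
      \<exists>x\<in>set L. p \<in> snd x \<and> snd x - {p} \<subseteq> {1..Q} \<times> M k"
  shows "distributed_computing_scheme Ks Fs Q T m h \<phi> (xor_scheme Q T M W L)"
proof -
  interpret mapreduce_problem Ks Fs Q T m h \<phi> by fact
  let ?S = "xor_scheme Q T M W L"
  have S: "mapped ?S = M" "assigned ?S = W" "broadcasts ?S = map (xor_broadcast T) L"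
    by (simp_all add: xor_scheme_def)
  have WQ: "q \<in> {1..Q}" if "k \<in> Ks" "q \<in> W k" for k q
    using that W(3) by blast
  have dec: "decoded Q ?S v k (q, f) = v (q, f)"
    if "v \<in> {1..Q} \<times> Fs \<rightarrow> {s. length s = T}" "k \<in> Ks" "q \<in> W k" "f \<in> Fs - M k" for v k q f
    using that L served[of k "(q, f)"] WQ[of k q] by (intro decoded_xor_scheme) auto
  have len: "length (message Q ?S v b) = nbits b" if "b \<in> set (broadcasts ?S)" for v b
  proof -
    from that obtain x where "x \<in> set L" "b = xor_broadcast T x" by (auto simp: S)
    then show ?thesis
      using L[of x] by (simp add: message_xor_broadcast S) (simp add: xor_broadcast_def xor_bits_def)
  qed
  \<comment> \<open>The outputs of the map functions are one instance of \<open>T\<close>-bit IVAs.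
    Mapped subfiles are read locally and the others decoded, so the reduce function receives its
    true arguments.\<close>
  have red: "h q (\<lambda>f\<in>Fs. gathered Q ?S (\<lambda>(q, f). m q f (x f)) k (q, f)) = \<phi> q x"
    if k: "k \<in> Ks" and q: "q \<in> W k" for x k q
  proof -
    have "gathered Q ?S (\<lambda>(q, f). m q f (x f)) k (q, f) = m q f (x f)" if "f \<in> Fs" for f
    proof (cases "f \<in> M k")
      case True
      then show ?thesis using WQ[OF k q] by (simp add: gathered_def local_ivas_def S)
    next
      case False
      have "(\<lambda>(q, f). m q f (x f)) \<in> {1..Q} \<times> Fs \<rightarrow> {s. length s = T}"
        using length_map by auto
      from dec[OF this k q] False that show ?thesis by (simp add: gathered_def S)
    qed
    then have "(\<lambda>f\<in>Fs. gathered Q ?S (\<lambda>(q, f). m q f (x f)) k (q, f)) = (\<lambda>f\<in>Fs. m q f (x f))"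
      by (simp cong: restrict_cong)
    then show ?thesis using output_eq[OF WQ[OF k q]] by simp
  qed
  have senders: "\<forall>b\<in>set (broadcasts ?S). sender b \<in> Ks"
    using L by (auto simp: S xor_broadcast_def)
  show ?thesis
    unfolding distributed_computing_scheme_def using M W dec len red senders by (simp add: S(1,2))
qed

text \<open>Numbers the functions so that \<open>w (k, j)\<close> is the \<open>j\<close>-th
  function of server \<open>k\<close>; the shuffle can then run in \<open>Q div card Ks\<close>
  rounds, one function per server in each.\<close>

lemma exists_assignment:
  assumes "finite Ks" "Ks \<noteq> {}" "card Ks dvd Q"
  obtains w where "bij_betw w (Ks \<times> {..<Q div card Ks}) {1..Q}"
  using finite_same_card_bij[of "Ks \<times> {..<Q div card Ks}" "{1..Q}"] assms
  by (auto simp: card_cartesian_product)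

section \<open>Double counting of the ones of a computing matrix\<close>

lemma identity_submatrix_ones:
  assumes "identity_submatrix Ks Fs C l B"
  shows "card {p \<in> fst B \<times> snd B. C (fst p) (snd p) = 1} = l"
proof -
  obtain \<sigma> where \<sigma>: "bij_betw \<sigma> (fst B) (snd B)" "card (fst B) = l"
    and C: "\<And>k f. k \<in> fst B \<Longrightarrow> f \<in> snd B \<Longrightarrow> C k f = (if f = \<sigma> k then 1 else 0)"
    using assms by (auto simp: identity_submatrix_def)
  have "{p \<in> fst B \<times> snd B. C (fst p) (snd p) = 1} = (\<lambda>k. (k, \<sigma> k)) ` fst B"
    using bij_betw_apply[OF \<sigma>(1)] by (auto simp: C split: if_splits)
  moreover have "inj_on (\<lambda>k. (k, \<sigma> k)) (fst B)" by (auto intro: inj_onI)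
  ultimately show ?thesis using \<sigma>(2) by (simp add: card_image)
qed

lemma computing_matrix_ones:
  assumes "computing_matrix Ks Fs K F r C"
  shows "card {p \<in> Ks \<times> Fs. C (fst p) (snd p) = 1} = F * (K - r)"
proof -
  have fin: "finite Ks" "finite Fs" and C: "\<And>k f. k \<in> Ks \<Longrightarrow> f \<in> Fs \<Longrightarrow> C k f \<in> {0, 1}"
    using assms by (auto simp: computing_matrix_def)
  have col: "card {k \<in> Ks. C k f = 1} = K - r" if "f \<in> Fs" for f
  proof -
    have "{k \<in> Ks. C k f = 1} = Ks - {k \<in> Ks. C k f = 0}" using C that by fastforce
    then show ?thesis using that assms by (auto simp: computing_matrix_def card_Diff_subset)
  qed
  \<comment> \<open>Swapping the pairs groups the ones by column, where their number is
    known.\<close>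
  have "{p \<in> Ks \<times> Fs. C (fst p) (snd p) = 1} = prod.swap ` (SIGMA f:Fs. {k \<in> Ks. C k f = 1})"
    by force
  then have "card {p \<in> Ks \<times> Fs. C (fst p) (snd p) = 1} = card (SIGMA f:Fs. {k \<in> Ks. C k f = 1})"
    by (simp add: card_image)
  also have "\<dots> = F * (K - r)"
    using fin col assms by (simp add: computing_matrix_def)
  finally show ?thesis .
qed

lemma finite_identity_submatrices:
  assumes "finite Ks" "finite Fs" "\<forall>B\<in>\<CC>. identity_submatrix Ks Fs C g B"
  shows "finite \<CC>"
proof (rule finite_subset)
  show "\<CC> \<subseteq> Pow Ks \<times> Pow Fs"
    using assms(3) by (fastforce simp: identity_submatrix_def)
qed (use assms in simp)

text \<open>The ones of \<open>C\<close> are the union of the ones of the members because these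
  cover, and the union is disjoint because they do not overlap. Each member contributes
  \<open>g\<close>.\<close>

lemma cover_card:
  assumes C: "computing_matrix Ks Fs K F r C"
    and cov: "identity_submatrix_cover Ks Fs C \<CC>" and non: "non_overlapping Ks Fs C \<CC>"
    and g: "\<forall>B\<in>\<CC>. identity_submatrix Ks Fs C g B"
  shows "card \<CC> * g = F * (K - r)"
proof -
  let ?ones = "\<lambda>B. {p \<in> fst B \<times> snd B. C (fst p) (snd p) = 1}"
  have fin: "finite Ks" "finite Fs" using C by (auto simp: computing_matrix_def)
  have sub: "fst B \<subseteq> Ks" "snd B \<subseteq> Fs" if "B \<in> \<CC>" for B
    using g that by (auto simp: identity_submatrix_def)
  have disj: "?ones B \<inter> ?ones B' = {}" if "B \<in> \<CC>" "B' \<in> \<CC>" "B \<noteq> B'" for B B'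
  proof (rule ccontr)
    assume "?ones B \<inter> ?ones B' \<noteq> {}"
    then obtain k f where "k \<in> fst B" "k \<in> fst B'" "f \<in> snd B" "f \<in> snd B'" "C k f = 1" by auto
    moreover from this have "k \<in> Ks" "f \<in> Fs" using sub that by blast+
    ultimately show False using non that unfolding non_overlapping_def covers_def by fastforce
  qed
  have "{p \<in> Ks \<times> Fs. C (fst p) (snd p) = 1} = (\<Union>B\<in>\<CC>. ?ones B)"
  proof (intro equalityI subsetI)
    fix p assume p: "p \<in> {p \<in> Ks \<times> Fs. C (fst p) (snd p) = 1}"
    then have "C (fst p) (snd p) \<noteq> 0" "fst p \<in> Ks" "snd p \<in> Fs" by auto
    then obtain B where "B \<in> \<CC>" "covers B (fst p) (snd p)"
      using cov unfolding identity_submatrix_cover_def by blast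
    then show "p \<in> (\<Union>B\<in>\<CC>. ?ones B)" using p by (auto simp: covers_def mem_Times_iff)
  qed (use sub in blast)
  then have "F * (K - r) = card (\<Union>B\<in>\<CC>. ?ones B)"
    using computing_matrix_ones[OF C] by simp
  also have "\<dots> = (\<Sum>B\<in>\<CC>. card (?ones B))"
  proof (rule card_UN_disjoint)
    show "\<forall>B\<in>\<CC>. finite (?ones B)"
      using fin sub by (blast intro: finite_subset[OF _ finite_cartesian_product[OF fin]])
  qed (use finite_identity_submatrices[OF fin g] disj in auto)
  also have "\<dots> = (\<Sum>B\<in>\<CC>. g)"
    using g by (intro sum.cong refl identity_submatrix_ones) blast
  also have "\<dots> = card \<CC> * g" by simp
  finally show ?thesis ..
qed

section \<open>Two transmissions for one identity submatrix\<close>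

lemma exists_xor_transmissions:
  assumes g: "g \<ge> 2" and B: "identity_submatrix Ks Fs C g B"
    and w: "\<And>k. k \<in> Ks \<Longrightarrow> w k \<in> {1..Q}"
  shows "\<exists>L. length L = 2 \<and>
    (\<forall>x\<in>set L. fst x \<in> Ks \<and> finite (snd x) \<and>
      snd x \<subseteq> {1..Q} \<times> {f \<in> Fs. C (fst x) f = 0}) \<and>
    (\<forall>k f. covers B k f \<longrightarrow> C k f \<noteq> 0 \<longrightarrow>
      (\<exists>x\<in>set L. (w k, f) \<in> snd x \<and> snd x - {(w k, f)} \<subseteq> {1..Q} \<times> {f \<in> Fs. C k f = 0}))"
proof -
  obtain \<sigma> where \<sigma>: "bij_betw \<sigma> (fst B) (snd B)"
    and C: "\<And>k f. k \<in> fst B \<Longrightarrow> f \<in> snd B \<Longrightarrow> C k f = (if f = \<sigma> k then 1 else 0)"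
    and sub: "fst B \<subseteq> Ks" "snd B \<subseteq> Fs" and card: "card (fst B) = g"
    using B by (auto simp: identity_submatrix_def)
  \<comment> \<open>As \<sigma> is injective, \<open>(k, \<sigma> k')\<close> is an off-diagonal
    entry of the submatrix, hence zero: server \<open>k\<close> has mapped
    \<open>\<sigma> k'\<close>.\<close>
  have known: "w k' \<in> {1..Q} \<and> \<sigma> k' \<in> Fs \<and> C k (\<sigma> k') = 0"
    if "k \<in> fst B" "k' \<in> fst B" "k' \<noteq> k" for k k'
    using that C[of k "\<sigma> k'"] bij_betw_apply[OF \<sigma>] w[of k'] sub
      bij_betw_imp_inj_on[OF \<sigma>, THEN inj_onD, of k' k] by auto
  have fin: "finite (fst B)" using card g by (intro card_ge_0_finite) simp
  obtain a b where ab: "a \<in> fst B" "b \<in> fst B" "a \<noteq> b"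
    using card g card_le_Suc0_iff_eq[OF fin] by auto
  \<comment> \<open>The demand of row server \<open>k\<close>: its function of the current round, on
    the only subfile of the submatrix that it has not mapped.\<close>
  let ?d = "\<lambda>k. (w k, \<sigma> k)"
  have knows: "?d ` (fst B - {k}) \<subseteq> {1..Q} \<times> {f \<in> Fs. C k f = 0}" if "k \<in> fst B" for k
    using known[OF that] by blast
  let ?L = "[(a, ?d ` (fst B - {a})), (b, {?d a})]"
  show ?thesis
  proof (intro exI[of _ ?L] conjI ballI allI impI)
    fix x assume "x \<in> set ?L"
    then consider "x = (a, ?d ` (fst B - {a}))" | "x = (b, {?d a})" by auto
    then have "fst x \<in> Ks \<and> finite (snd x) \<and> snd x \<subseteq> {1..Q} \<times> {f \<in> Fs. C (fst x) f = 0}"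
    proof cases
      case 1
      then show ?thesis using knows[OF ab(1)] ab(1) sub(1) fin by auto
    next
      case 2
      then show ?thesis using knows[OF ab(2)] ab sub(1) by auto
    qed
    then show "fst x \<in> Ks" "finite (snd x)" "snd x \<subseteq> {1..Q} \<times> {f \<in> Fs. C (fst x) f = 0}"
      by simp_all
  next
    fix k f assume "covers B k f" "C k f \<noteq> 0"
    then have k: "k \<in> fst B" and f: "f = \<sigma> k"
      using C[of k f] by (auto simp: covers_def split: if_splits)
    show "\<exists>x\<in>set ?L. (w k, f) \<in> snd x \<and>
        snd x - {(w k, f)} \<subseteq> {1..Q} \<times> {f \<in> Fs. C k f = 0}"
    \<comment> \<open>Server \<open>a\<close> gets its demand in the clear from \<open>b\<close>.
      Any other row server finds its demand in the sum sent by \<open>a\<close> and knows the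
      remaining terms.\<close>
    proof (cases "k = a")
      case True
      then show ?thesis using f by auto
    next
      case False
      have "?d ` (fst B - {a}) - {?d k} \<subseteq> {1..Q} \<times> {f \<in> Fs. C k f = 0}"
        using knows[OF k] by blast
      then show ?thesis using False k f by auto
    qed
  qed simp
qed

theorem theorem6:
  fixes Ks :: "'k set" and Fs :: "'f set" and K F r g Q T :: nat
    and C :: "'k \<Rightarrow> 'f \<Rightarrow> nat" and \<CC> :: "('k set \<times> 'f set) set"
    and m :: "nat \<Rightarrow> 'f \<Rightarrow> 'w \<Rightarrow> bool list"
    and h :: "nat \<Rightarrow> ('f \<Rightarrow> bool list) \<Rightarrow> 'o"
    and \<phi> :: "nat \<Rightarrow> ('f \<Rightarrow> 'w) \<Rightarrow> 'o"
  assumes "mapreduce_problem Ks Fs Q T m h \<phi>"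
    and "computing_matrix Ks Fs K F r C"
    and "identity_submatrix_cover Ks Fs C \<CC>"
    and "non_overlapping Ks Fs C \<CC>"
    and "g \<ge> 2"
    and "\<forall>B\<in>\<CC>. identity_submatrix Ks Fs C g B"
  shows "\<exists>S. distributed_computing_scheme Ks Fs Q T m h \<phi> S \<and>
             has_computation_load Ks Fs S r \<and>
             communication_load Fs Q T S = 2 / real g * (1 - real r / real K)"
proof -
  interpret mapreduce_problem Ks Fs Q T m h \<phi> by fact
  let ?\<beta> = "Q div card Ks"
  define M where "M k = {f \<in> Fs. C k f = 0}" for k
  obtain w where w: "bij_betw w (Ks \<times> {..<?\<beta>}) {1..Q}"
    using exists_assignment[OF finite_servers servers_nonempty servers_dvd_Q] .
  define W where "W k = (\<lambda>j. w (k, j)) ` {..<?\<beta>}" for k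
  have inj: "inj_on w (Ks \<times> {..<?\<beta>})" and wQ: "w ` (Ks \<times> {..<?\<beta>}) = {1..Q}"
    using w by (simp_all add: bij_betw_def)
  have W_card: "card (W k) = ?\<beta>" if "k \<in> Ks" for k
    using that inj unfolding W_def by (subst card_image) (auto simp: inj_on_def)
  have W_disj: "disjoint_family_on W Ks"
    using inj unfolding W_def disjoint_family_on_def by (fastforce dest: inj_onD)
  have W_UN: "(\<Union>k\<in>Ks. W k) = {1..Q}"
    unfolding wQ[symmetric] W_def by blast
  \<comment> \<open>The conclusion of \<open>exists_xor_transmissions\<close> for submatrix
    \<open>B\<close> in round \<open>j\<close>, named so that one list per pair can be
    chosen.\<close>
  define ok where "ok B j L \<longleftrightarrow> length L = 2 \<and>
      (\<forall>x\<in>set L. fst x \<in> Ks \<and> finite (snd x) \<and> snd x \<subseteq> {1..Q} \<times> M (fst x)) \<and>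
      (\<forall>k f. covers B k f \<longrightarrow> C k f \<noteq> 0 \<longrightarrow>
        (\<exists>x\<in>set L. (w (k, j), f) \<in> snd x \<and> snd x - {(w (k, j), f)} \<subseteq> {1..Q} \<times> M k))"
    for B j and L :: "('k \<times> (nat \<times> 'f) set) list"
  define X where "X B j = (SOME L. ok B j L)" for B j
  have ok: "ok B j (X B j)" if "B \<in> \<CC>" "j < ?\<beta>" for B j
  proof -
    have "w (k, j) \<in> {1..Q}" if "k \<in> Ks" for k
      using that \<open>j < ?\<beta>\<close> wQ by blast
    then have "\<exists>L. ok B j L"
      unfolding ok_def M_def using assms(6) that(1)
      by (intro exists_xor_transmissions[OF assms(5), where w = "\<lambda>k. w (k, j)"]) blast+
    then show ?thesis unfolding X_def by (rule someI_ex)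
  qed
  note X = ok[unfolded ok_def]
  \<comment> \<open>The load counts list entries, so the cover is enumerated without repetition to
    get exactly two transmissions per submatrix and round.\<close>
  obtain Bs where Bs: "set Bs = \<CC>" "distinct Bs"
    using finite_distinct_list finite_identity_submatrices[OF finite_servers finite_subfiles assms(6)]
    by blast
  define L where "L = concat (map (\<lambda>(B, j). X B j) (List.product Bs [0..<?\<beta>]))"
  have set_L: "set L = (\<Union>B\<in>\<CC>. \<Union>j<?\<beta>. set (X B j))"
    unfolding L_def using Bs(1) by force
  have "length L = (\<Sum>(B, j)\<leftarrow>List.product Bs [0..<?\<beta>]. 2)"
    unfolding L_def length_concat map_map
    by (intro arg_cong[where f = sum_list] map_cong) (auto simp: X Bs(1))
  then have length_L: "length L = 2 * (card \<CC> * ?\<beta>)"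
    using Bs by (simp add: case_prod_beta' sum_list_triv flip: distinct_card)
  let ?S = "xor_scheme Q T M W L"
  have "distributed_computing_scheme Ks Fs Q T m h \<phi> ?S"
  proof (rule xor_scheme_correct[OF assms(1) _ W_card W_disj W_UN])
    show "M k \<subseteq> Fs" for k by (auto simp: M_def)
    show "fst x \<in> Ks \<and> finite (snd x) \<and> snd x \<subseteq> {1..Q} \<times> M (fst x)" if "x \<in> set L" for x
      using that X unfolding set_L by blast
    show "\<exists>x\<in>set L. p \<in> snd x \<and> snd x - {p} \<subseteq> {1..Q} \<times> M k"
      if k: "k \<in> Ks" and p: "p \<in> W k \<times> (Fs - M k)" for k p
    proof -
      \<comment> \<open>A missing IVA fixes a round \<open>j\<close> and a one of \<open>C\<close>
        at \<open>(k, f)\<close>. The submatrix covering that one serves it in round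
        \<open>j\<close>.\<close>
      obtain j f where jf: "j < ?\<beta>" "p = (w (k, j), f)" "f \<in> Fs" "C k f \<noteq> 0"
        using p by (auto simp: W_def M_def)
      then obtain B where "B \<in> \<CC>" "covers B k f"
        using assms(3) k unfolding identity_submatrix_cover_def by blast
      moreover from this have "\<exists>x\<in>set (X B j). p \<in> snd x \<and> snd x - {p} \<subseteq> {1..Q} \<times> M k"
        using X[of B j] jf by blast
      ultimately show ?thesis using jf(1) unfolding set_L by blast
    qed
  qed
  moreover have "has_computation_load Ks Fs ?S r"
    using assms(2) by (simp add: has_computation_load_def computing_matrix_def xor_scheme_def M_def)
  moreover have "communication_load Fs Q T ?S = 2 / real g * (1 - real r / real K)"
  proof -
    have K: "card Ks = K" and F: "card Fs = F" using assms(2) by (auto simp: computing_matrix_def)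
    have pos: "K > 0" "F > 0"
      using servers_nonempty finite_servers servers_le_subfiles K F by (auto simp: card_gt_0_iff)
    \<comment> \<open>Any column shows \<open>r \<le> K\<close>, and there is one because
      \<open>F \<ge> K > 0\<close>. The bound turns the truncated \<open>K - r\<close> of
      \<open>cover_card\<close> into a real difference.\<close>
    then obtain f where "f \<in> Fs" using F by fastforce
    then have "r = card {k \<in> Ks. C k f = 0}"
      using assms(2) by (simp add: computing_matrix_def)
    also have "\<dots> \<le> K" unfolding K[symmetric] using finite_servers by (intro card_mono) auto
    finally have "r \<le> K" .
    then have ones: "real (card \<CC>) = real F * (real K - real r) / real g"
      using arg_cong[OF cover_card[OF assms(2-4,6)], of real] assms(5)
      by (simp add: field_simps)
    \<comment> \<open>The shuffle sends \<open>2 * card \<CC> * ?\<beta> * T\<close> bits. With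
      \<open>Q\<close> factored this way, the nonzero \<open>?\<beta>\<close> and \<open>T\<close>
      cancel from the load.\<close>
    have "real Q = real ?\<beta> * real K" using servers_dvd_Q K by (simp flip: of_nat_mult)
    moreover have "?\<beta> \<noteq> 0" using Q_pos servers_dvd_Q by (simp add: dvd_div_eq_0_iff)
    moreover have "(\<Sum>b\<leftarrow>broadcasts ?S. nbits b) = length L * T"
      by (simp add: xor_scheme_def xor_broadcast_def comp_def sum_list_triv)
    ultimately have "communication_load Fs Q T ?S = 2 * real (card \<CC>) / (real K * real F)"
      using T_pos by (simp add: communication_load_def length_L F)
    then show ?thesis using pos assms(5) by (simp add: ones divide_simps)
  qed
  ultimately show ?thesis by blast
qed

end
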